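(* Let $\hat\theta_{\mathrm{MLE}}\in\operatorname{argmax}_{\theta\in\Theta}\mathcal{L}(\theta)$ be a maximum likelihood estimate. Then $\hat\theta_{\mathrm{MLE}}$ is an equilibrium of the discrete-time dynamical system $\theta[k+1]=F^{\mathrm{EM}}(\theta[k])$, $k\in\{0,1,2,\dots\}$; that is, $F^{\mathrm{EM}}(\hat\theta_{\mathrm{MLE}})=\hat\theta_{\mathrm{MLE}}$.
   Context: Setting: $\Theta\subseteq\mathbb{R}^p$ is a parameter set and $y\in\mathbb{R}^m$ is a fixed data vector. For each $\theta\in\Theta$, $p_\theta(x,y)$ is a joint probability density in $(x,y)\in\mathbb{R}^n\times\mathbb{R}^m$, with marginal $p_\theta(y)=\int p_\theta(x,y)\,dx$. The likelihood function is $\mathcal{L}:\Theta\to\mathbb{R}$, $\mathcal{L}(\theta)=p_\theta(y)$, and $p_\theta(x|y)=p_\theta(x,y)/p_\theta(y)$. All random vectors are continuous (have densities). Standing assumptions: (i) $\mathcal{L}(\theta)>0$ for every $\theta\in\Theta$. (ii) The set $\mathcal{X}=\{x\in\mathbb{R}^n: p_\theta(x,y)>0\}$ does not depend on $\theta\in\Theta$. The function $Q:\Theta\times\Theta\to\mathbb{R}$ is defined by $Q(\theta,\theta')=\int_{\mathcal{X}}p_{\theta'}(x|y)\log p_\theta(x,y)\,dx$. (iii) For each $\theta'\in\Theta$, $Q(\cdot,\theta')$ has a unique global maximizer in $\Theta$; $F^{\mathrm{EM}}:\Theta\to\Theta$ is defined by $F^{\mathrm{EM}}(\theta')=\operatorname{argmax}_{\theta\in\Theta}Q(\theta,\theta')$.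 An equilibrium of $\theta[k+1]=F(\theta[k])$ is a point $\theta^\star\in\Theta$ with $F(\theta^\star)=\theta^\star$. *)

theory Defs
  imports "HOL-Probability.Probability"
begin

(* Pointwise nonnegativity and Borel measurability, rather than almost-everywhere
   versions: the density is later restricted to the null set UNIV \<times> {y}. *)
definition is_prob_density :: "('a::euclidean_space \<Rightarrow> real) \<Rightarrow> bool" where
  "is_prob_density f \<longleftrightarrow>
     f \<in> borel_measurable borel \<and> (\<forall>z. 0 \<le> f z) \<and>
     prob_space (density lborel (\<lambda>z. ennreal (f z)))"

(* The Bochner integral is 0 if the section at y is not integrable. For a probability
   density, a positive likelihood therefore means that the marginal is positive and finite. *)
definition likelihood ::
    "('t \<Rightarrow> 'a::euclidean_space \<times> 'b::euclidean_space \<Rightarrow> real) \<Rightarrow> 'b \<Rightarrow> 't \<Rightarrow> real" where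
  "likelihood p y \<theta> = (LINT x|lborel. p \<theta> (x, y))"

definition cond_density ::
    "('t \<Rightarrow> 'a::euclidean_space \<times> 'b::euclidean_space \<Rightarrow> real) \<Rightarrow> 'b \<Rightarrow> 't \<Rightarrow> 'a \<Rightarrow> real" where
  "cond_density p y \<theta> x = p \<theta> (x, y) / likelihood p y \<theta>"

definition em_integrand ::
    "('t \<Rightarrow> 'a::euclidean_space \<times> 'b::euclidean_space \<Rightarrow> real) \<Rightarrow> 'b \<Rightarrow> 't \<Rightarrow> 't \<Rightarrow> 'a \<Rightarrow> real" where
  "em_integrand p y \<theta> \<theta>' x = cond_density p y \<theta>' x * ln (p \<theta> (x, y))"

definition em_Q ::
    "('t \<Rightarrow> 'a::euclidean_space \<times> 'b::euclidean_space \<Rightarrow> real) \<Rightarrow> 'b \<Rightarrow> 'a set \<Rightarrow> 't \<Rightarrow> 't \<Rightarrow> real" where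
  "em_Q p y X \<theta> \<theta>' = (LINT x:X|lborel. em_integrand p y \<theta> \<theta>' x)"

definition em_map ::
    "'t set \<Rightarrow> ('t \<Rightarrow> 'a::euclidean_space \<times> 'b::euclidean_space \<Rightarrow> real) \<Rightarrow> 'b \<Rightarrow> 'a set \<Rightarrow> 't \<Rightarrow> 't" where
  "em_map \<Theta> p y X \<theta>' = arg_max (\<lambda>\<theta>. em_Q p y X \<theta> \<theta>') (\<lambda>\<theta>. \<theta> \<in> \<Theta>)"

definition equilibrium :: "'t set \<Rightarrow> ('t \<Rightarrow> 't) \<Rightarrow> 't \<Rightarrow> bool" where
  "equilibrium \<Theta> F \<theta> \<longleftrightarrow> \<theta> \<in> \<Theta> \<and> F \<theta> = \<theta>"

end

theory Submission
  imports Defs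
begin

text \<open>
  At a fixed value \<open>y\<close>, write \<open>L\<close> for the likelihood. The increment of \<open>Q\<close> in its first argument is
  dominated by the relative increment of the likelihood:
  \[
    Q(\theta,\theta') - Q(\theta',\theta')
      = \int_X \frac{p_{\theta'}(x,y)}{L(\theta')} \log\frac{p_\theta(x,y)}{p_{\theta'}(x,y)}\,dx
      \le \int_X \frac{p_\theta(x,y) - p_{\theta'}(x,y)}{L(\theta')}\,dx
      = \frac{L(\theta) - L(\theta')}{L(\theta')},
  \]
  by \<open>ln u \<le> u - 1\<close> (lemma \<open>em_Q_increment_le\<close>).

  If \<open>\<theta>'\<close> maximizes \<open>L\<close>, the right-hand side is nonpositive for every \<open>\<theta>\<close>, so \<open>\<theta>'\<close> is itself a
  maximizer of \<open>Q(\<cdot>, \<theta>')\<close>. Since that maximizer is unique, the EM map returns \<open>\<theta>'\<close>.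
\<close>

lemma mult_ln_diff_le:
  fixes a b :: real
  assumes "0 < a" "0 < b"
  shows "a * (ln b - ln a) \<le> b - a"
proof -
  have "ln b - ln a \<le> b / a - 1"
    using ln_le_minus_one[of "b / a"] assms by (simp add: ln_div)
  then have "a * (ln b - ln a) \<le> a * (b / a - 1)"
    using assms by (intro mult_left_mono) auto
  also have "\<dots> = b - a"
    using assms by (simp add: field_simps)
  finally show ?thesis .
qed

text \<open>
  The Bochner integral of a non-integrable function is 0, so positivity of the likelihood carries
  integrability of the section of the joint density at \<open>y\<close>.
\<close>
lemma integrable_section_of_likelihood_pos:
  assumes "0 < likelihood p y \<theta>"
  shows "integrable lborel (\<lambda>x. p \<theta> (x, y))"
  using assms not_integrable_integral_eq unfolding likelihood_def by fastforce

text \<open>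
  The common support makes both logarithms finite on \<open>X\<close>. Outside \<open>X\<close> both densities vanish, and
  therefore the integral over \<open>X\<close> of their difference is the difference of the full marginals.
\<close>
lemma em_Q_increment_le:
  fixes p :: "'t \<Rightarrow> 'a::euclidean_space \<times> 'b::euclidean_space \<Rightarrow> real"
  assumes nonneg: "\<And>x. 0 \<le> p \<theta> (x, y)" "\<And>x. 0 \<le> p \<theta>' (x, y)"
    and support: "{x. p \<theta> (x, y) > 0} = X" "{x. p \<theta>' (x, y) > 0} = X"
    and pos: "0 < likelihood p y \<theta>" "0 < likelihood p y \<theta>'"
    and int: "set_integrable lborel X (em_integrand p y \<theta> \<theta>')"
      "set_integrable lborel X (em_integrand p y \<theta>' \<theta>')"
  shows "em_Q p y X \<theta> \<theta>' - em_Q p y X \<theta>' \<theta>'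
           \<le> (likelihood p y \<theta> - likelihood p y \<theta>') / likelihood p y \<theta>'"
proof -
  let ?L = "likelihood p y \<theta>'"
  let ?d = "\<lambda>x. em_integrand p y \<theta> \<theta>' x - em_integrand p y \<theta>' \<theta>' x"
  have section_int: "integrable lborel (\<lambda>x. p \<theta> (x, y))" "integrable lborel (\<lambda>x. p \<theta>' (x, y))"
    by (rule pos[THEN integrable_section_of_likelihood_pos])+
  have pointwise: "indicator X x *\<^sub>R ?d x \<le> (p \<theta> (x, y) - p \<theta>' (x, y)) / ?L" for x
  proof (cases "x \<in> X")
    case True
    then have "0 < p \<theta>' (x, y)" "0 < p \<theta> (x, y)"
      using support by auto
    then have "p \<theta>' (x, y) * (ln (p \<theta> (x, y)) - ln (p \<theta>' (x, y))) / ?L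
                 \<le> (p \<theta> (x, y) - p \<theta>' (x, y)) / ?L"
      using pos(2) by (intro divide_right_mono mult_ln_diff_le) auto
    then show ?thesis
      using True by (simp add: em_integrand_def cond_density_def diff_divide_distrib right_diff_distrib)
  next
    case False
    then have "p \<theta> (x, y) = 0" "p \<theta>' (x, y) = 0"
      using support nonneg[of x] by force+
    then show ?thesis
      using False by simp
  qed
  have "em_Q p y X \<theta> \<theta>' - em_Q p y X \<theta>' \<theta>' = (LINT x:X|lborel. ?d x)"
    unfolding em_Q_def using int by (simp add: set_integral_diff(2))
  also have "\<dots> \<le> (LINT x|lborel. (p \<theta> (x, y) - p \<theta>' (x, y)) / ?L)"
    unfolding set_lebesgue_integral_def
  proof (rule integral_mono)
    show "integrable lborel (\<lambda>x. indicator X x *\<^sub>R ?d x)"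
      using set_integral_diff(1)[OF int] unfolding set_integrable_def .
    show "integrable lborel (\<lambda>x. (p \<theta> (x, y) - p \<theta>' (x, y)) / ?L)"
      using section_int by simp
  qed (rule pointwise)
  also have "\<dots> = (likelihood p y \<theta> - ?L) / ?L"
    using section_int by (simp add: likelihood_def)
  finally show ?thesis .
qed

theorem proposition1:
  fixes \<Theta> :: "(real ^ 'p) set"
    and p :: "real ^ 'p \<Rightarrow> (real ^ 'n) \<times> (real ^ 'm) \<Rightarrow> real"
    and y :: "real ^ 'm"
    and X :: "(real ^ 'n) set"
    and \<theta>_MLE :: "real ^ 'p"
  assumes density: "\<And>\<theta>. \<theta> \<in> \<Theta> \<Longrightarrow> is_prob_density (p \<theta>)"
    and likelihood_pos: "\<And>\<theta>. \<theta> \<in> \<Theta> \<Longrightarrow> likelihood p y \<theta> > 0"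
    and support: "\<And>\<theta>. \<theta> \<in> \<Theta> \<Longrightarrow> {x. p \<theta> (x, y) > 0} = X"
    and Q_real: "\<And>\<theta> \<theta>'. \<theta> \<in> \<Theta> \<Longrightarrow> \<theta>' \<in> \<Theta> \<Longrightarrow>
                   set_integrable lborel X (em_integrand p y \<theta> \<theta>')"
    and unique_max: "\<And>\<theta>'. \<theta>' \<in> \<Theta> \<Longrightarrow>
                       \<exists>!\<theta>. is_arg_max (\<lambda>\<theta>. em_Q p y X \<theta> \<theta>') (\<lambda>\<theta>. \<theta> \<in> \<Theta>) \<theta>"
    and mle: "is_arg_max (likelihood p y) (\<lambda>\<theta>. \<theta> \<in> \<Theta>) \<theta>_MLE"
  shows "equilibrium \<Theta> (em_map \<Theta> p y X) \<theta>_MLE"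
proof -
  have MLE_in: "\<theta>_MLE \<in> \<Theta>"
    using mle by (simp add: is_arg_max_linorder)
  have MLE_le: "likelihood p y \<theta> \<le> likelihood p y \<theta>_MLE" if "\<theta> \<in> \<Theta>" for \<theta>
    using mle that by (auto simp: is_arg_max_linorder)
  have "em_Q p y X \<theta> \<theta>_MLE \<le> em_Q p y X \<theta>_MLE \<theta>_MLE" if "\<theta> \<in> \<Theta>" for \<theta>
  proof -
    have "em_Q p y X \<theta> \<theta>_MLE - em_Q p y X \<theta>_MLE \<theta>_MLE
            \<le> (likelihood p y \<theta> - likelihood p y \<theta>_MLE) / likelihood p y \<theta>_MLE"
      using density[OF that] density[OF MLE_in] support[OF that] support[OF MLE_in]
        likelihood_pos[OF that] likelihood_pos[OF MLE_in]
        Q_real[OF that MLE_in] Q_real[OF MLE_in MLE_in]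
      by (intro em_Q_increment_le) (auto simp: is_prob_density_def)
    also have "\<dots> \<le> 0"
      using MLE_le[OF that] likelihood_pos[OF MLE_in] by (intro divide_nonpos_pos) auto
    finally show ?thesis by simp
  qed
  then have MLE_max: "is_arg_max (\<lambda>\<theta>. em_Q p y X \<theta> \<theta>_MLE) (\<lambda>\<theta>. \<theta> \<in> \<Theta>) \<theta>_MLE"
    using MLE_in by (simp add: is_arg_max_linorder)
  have "em_map \<Theta> p y X \<theta>_MLE = \<theta>_MLE"
    unfolding em_map_def arg_max_def
    using unique_max[OF MLE_in] MLE_max by (rule some1_equality)
  then show ?thesis
    using MLE_in by (simp add: equilibrium_def)
qed

end
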